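(* The Mostow decomposition $SL(2,\mathbb{C})=SU(2)\times\exp i\mathfrak{m}\times\exp i\mathfrak{t}$ maps a matrix $\begin{pmatrix}a&b\\c&d\end{pmatrix}\in SL(2,\mathbb{C})$ to the product $k\cdot f\cdot e$, where $$e:=\begin{pmatrix}\alpha&0\\0&1/\alpha\end{pmatrix}\in\exp i\mathfrak{t},\qquad \alpha:=\left(\frac{|a|^2+|c|^2}{|b|^2+|d|^2}\right)^{1/4},$$ $$f:=\begin{pmatrix}\cosh|\beta|&\frac{\beta}{|\beta|}\sinh|\beta|\\ \frac{\bar\beta}{|\beta|}\sinh|\beta|&\cosh|\beta|\end{pmatrix}\in\exp i\mathfrak{m},$$ with $$\beta:=\frac{\bar a b+\bar c d}{|\bar a b+\bar c d|}\cdot\frac{\ln\left(\sqrt{(|a|^2+|c|^2)(|b|^2+|d|^2)}+|\bar a b+\bar c d|\right)}{2},$$ and $$k:=\begin{pmatrix}a&b\\c&d\end{pmatrix}e^{-1}f^{-1}\in SU(2).$$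
   Context: $SL(2,\mathbb{C})$ is the group of complex $2\times2$ matrices of determinant $1$, and $SU(2)$ its subgroup of unitary matrices. $i\mathfrak{t}:=\left\{\begin{pmatrix}s&0\\0&-s\end{pmatrix}:s\in\mathbb{R}\right\}$ and $i\mathfrak{m}:=\left\{\begin{pmatrix}0&\bar\gamma\\ \gamma&0\end{pmatrix}:\gamma\in\mathbb{C}\right\}$; $\exp$ is the matrix exponential. The Mostow decomposition of $g\in SL(2,\mathbb{C})$ is the unique triple $(k,f,e)\in SU(2)\times\exp i\mathfrak{m}\times\exp i\mathfrak{t}$ with $g=k\cdot f\cdot e$ (by Mostow's theorem, multiplication $SU(2)\times\exp i\mathfrak{m}\times\exp i\mathfrak{t}\to SL(2,\mathbb{C})$ is a diffeomorphism). When $\bar a b+\bar c d=0$, one sets $\beta=0$ and $f$ is the identity matrix. *)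

theory Defs
  imports "HOL-Analysis.Analysis"
begin

type_synonym cmat2 = "complex ^ 2 ^ 2"

definition mat2 :: "complex \<Rightarrow> complex \<Rightarrow> complex \<Rightarrow> complex \<Rightarrow> cmat2" where
  "mat2 a b c d = vector [vector [a, b], vector [c, d]]"

definition conj_transpose :: "cmat2 \<Rightarrow> cmat2" where
  "conj_transpose A = (\<chi> i j. cnj (A $ j $ i))"

(* The instance of times for vec is componentwise, so neither the power of class monoid_mult
   nor the library's exp can be used for matrices. *)
definition mat_power :: "cmat2 \<Rightarrow> nat \<Rightarrow> cmat2" where
  "mat_power A n = (((**) A) ^^ n) (mat 1)"

definition mat_exp :: "cmat2 \<Rightarrow> cmat2" where
  "mat_exp A = (\<Sum>n. (1 / fact n) *\<^sub>R mat_power A n)"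

definition SL2 :: "cmat2 set" where
  "SL2 = {g. det g = 1}"

definition SU2 :: "cmat2 set" where
  "SU2 = {k \<in> SL2. conj_transpose k ** k = mat 1 \<and> k ** conj_transpose k = mat 1}"

definition i_t :: "cmat2 set" where
  "i_t = {mat2 (of_real s) 0 0 (- of_real s) | s :: real. True}"

definition i_m :: "cmat2 set" where
  "i_m = {mat2 0 (cnj \<gamma>) \<gamma> 0 | \<gamma> :: complex. True}"

definition is_mostow_triple :: "cmat2 \<Rightarrow> cmat2 \<times> cmat2 \<times> cmat2 \<Rightarrow> bool" where
  "is_mostow_triple g = (\<lambda>(k, f, e).
     k \<in> SU2 \<and> f \<in> mat_exp ` i_m \<and> e \<in> mat_exp ` i_t \<and> g = k ** f ** e)"

definition mostow_decomposition :: "cmat2 \<Rightarrow> cmat2 \<times> cmat2 \<times> cmat2" where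
  "mostow_decomposition g = (THE p. is_mostow_triple g p)"

end

(* The entries P, z, cnj z, Q of g^* g determine the decomposition: g = k f e with k unitary and
   f, e hermitian is equivalent to g^* g = e f f e. For e = diag(t, 1/t) and f with diagonal entries
   h > 0, off-diagonal entries w, cnj w and h^2 = 1 + |w|^2 this says P = t^2 (2 h^2 - 1),
   Q = (2 h^2 - 1) / t^2 and z = 2 h w. Hence t^4 = P / Q, which yields t, then h, then w.
   The matrices built from \<alpha> and \<beta> solve these equations because P Q - |z|^2 = |det g|^2 = 1, so that
   exp (2 |\<beta>|) = sqrt (P Q) + |z| means cosh (2 |\<beta>|) = sqrt (P Q) and sinh (2 |\<beta>|) = |z|. *)

theory Submission
  imports Defs
begin

section \<open>Arithmetic of complex 2x2 matrices\<close>

lemma mat2_component [simp]: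
  "mat2 a b c d $ 1 $ 1 = a" "mat2 a b c d $ 1 $ 2 = b"
  "mat2 a b c d $ 2 $ 1 = c" "mat2 a b c d $ 2 $ 2 = d"
  by (simp_all add: mat2_def)

lemma cmat2_eq_iff:
  "(A :: cmat2) = B \<longleftrightarrow> A $ 1 $ 1 = B $ 1 $ 1 \<and> A $ 1 $ 2 = B $ 1 $ 2
     \<and> A $ 2 $ 1 = B $ 2 $ 1 \<and> A $ 2 $ 2 = B $ 2 $ 2"
  by (auto simp: vec_eq_iff forall_2)

lemma mat2_eq_iff:
  "mat2 a b c d = mat2 a' b' c' d' \<longleftrightarrow> a = a' \<and> b = b' \<and> c = c' \<and> d = d'"
  by (simp add: cmat2_eq_iff)

lemma mat2_mult:
  "mat2 a b c d ** mat2 a' b' c' d'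
     = mat2 (a * a' + b * c') (a * b' + b * d') (c * a' + d * c') (c * b' + d * d')"
  by (simp add: cmat2_eq_iff matrix_matrix_mult_def sum_2)

lemma mat_1_eq_mat2: "mat 1 = mat2 1 0 0 1"
  by (simp add: cmat2_eq_iff mat_def)

lemma scaleR_mat2:
  "x *\<^sub>R mat2 a b c d = mat2 (of_real x * a) (of_real x * b) (of_real x * c) (of_real x * d)"
  by (simp add: cmat2_eq_iff) (simp add: scaleR_conv_of_real)

lemma conj_transpose_mat2:
  "conj_transpose (mat2 a b c d) = mat2 (cnj a) (cnj c) (cnj b) (cnj d)"
  by (simp add: cmat2_eq_iff conj_transpose_def)

lemma det_mat2: "det (mat2 a b c d) = a * d - b * c"
  by (simp add: det_2)

lemma matrix_inv_inverse:
  assumes "invertible A"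
  shows "A ** matrix_inv A = mat 1" "matrix_inv A ** A = mat 1"
  using someI_ex[OF assms[unfolded invertible_def]] by (simp_all add: matrix_inv_def)

lemma conj_transpose_mult:
  "conj_transpose (A ** B) = conj_transpose B ** conj_transpose A"
  unfolding cmat2_eq_iff by (simp add: conj_transpose_def matrix_matrix_mult_def sum_2 mult.commute)

lemma conj_transpose_mat_1: "conj_transpose (mat 1) = mat 1"
  by (simp add: mat_1_eq_mat2 conj_transpose_mat2)

section \<open>Exponentials of \<open>i_t\<close> and \<open>i_m\<close>\<close>

lemma sums_mat2:
  assumes "p sums a" "q sums b" "r sums c" "s sums d"
  shows "(\<lambda>n. mat2 (p n) (q n) (r n) (s n)) sums mat2 a b c d"
proof -
  have eq: "(\<Sum>i<n. mat2 (p i) (q i) (r i) (s i))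
      = mat2 (\<Sum>i<n. p i) (\<Sum>i<n. q i) (\<Sum>i<n. r i) (\<Sum>i<n. s i)" for n
    by (simp add: cmat2_eq_iff)
  have "\<forall>i j. (\<lambda>n. mat2 (\<Sum>i<n. p i) (\<Sum>i<n. q i) (\<Sum>i<n. r i) (\<Sum>i<n. s i) $ i $ j)
      \<longlonglongrightarrow> mat2 a b c d $ i $ j"
    using assms by (simp add: forall_2 sums_def)
  then show ?thesis
    unfolding sums_def eq by (auto intro!: vec_tendstoI)
qed

lemma mat_exp_diagonal:
  "mat_exp (mat2 (of_real s) 0 0 (- of_real s)) = mat2 (of_real (exp s)) 0 0 (of_real (exp (- s)))"
proof -
  have pow: "mat_power (mat2 (of_real s) 0 0 (- of_real s)) n
      = mat2 (of_real (s ^ n)) 0 0 (of_real ((- s) ^ n))" for n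
    by (induction n) (simp_all add: mat_power_def mat_1_eq_mat2 mat2_mult)
  have exp_sums: "(\<lambda>n. complex_of_real (1 / fact n) * of_real (x ^ n)) sums of_real (exp x)" for x :: real
    using sums_of_real[OF exp_converges[of x], where 'a = complex] by (simp add: divide_inverse scaleR_conv_of_real)
  show ?thesis
    unfolding mat_exp_def pow scaleR_mat2
    by (intro sums_unique[symmetric] sums_mat2 exp_sums) simp_all
qed

text \<open>For \<^term>\<open>\<gamma> = 0\<close> the quotients by \<^term>\<open>cmod \<gamma>\<close> are 0, which is the correct off-diagonal entry.\<close>

lemma mat_exp_antidiagonal:
  fixes \<gamma> :: complex
  defines "r \<equiv> cmod \<gamma>"
  shows "mat_exp (mat2 0 (cnj \<gamma>) \<gamma> 0)
    = mat2 (of_real (cosh r)) (cnj \<gamma> / of_real r * of_real (sinh r))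
           (\<gamma> / of_real r * of_real (sinh r)) (of_real (cosh r))"
proof -
  \<comment> \<open>The square of the antidiagonal matrix is \<open>r^2\<close> times the identity,
    so even powers are scalar and odd powers are multiples of the matrix itself. \<open>C\<close>
    and \<open>S\<close> hold these coefficients; their exponential series are those of cosh and
    sinh.\<close>
  define C where "C n = (if even n then r ^ n else 0)" for n
  define S where "S n = (if even n then 0 else r ^ n)" for n
  have gamma_cnj: "\<gamma> * cnj \<gamma> = of_real (r * r)"
    unfolding r_def by (metis complex_norm_square power2_eq_square of_real_power)
  have gamma_0: "r = 0 \<Longrightarrow> \<gamma> = 0"
    by (simp add: r_def)
  have pow: "mat_power (mat2 0 (cnj \<gamma>) \<gamma> 0) n
      = mat2 (of_real (C n)) (cnj \<gamma> / of_real r * of_real (S n))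
             (\<gamma> / of_real r * of_real (S n)) (of_real (C n))" for n
  proof (induction n)
    case 0
    show ?case by (simp add: mat_power_def mat_1_eq_mat2 C_def S_def)
  next
    case (Suc n)
    have "of_real (C (Suc n)) = \<gamma> * cnj \<gamma> / of_real r * of_real (S n)"
      unfolding gamma_cnj by (simp add: C_def S_def)
    moreover have "\<gamma> / of_real r * of_real (S (Suc n)) = \<gamma> * of_real (C n)"
      "cnj \<gamma> / of_real r * of_real (S (Suc n)) = cnj \<gamma> * of_real (C n)"
      \<comment> \<open>For \<open>r = 0\<close> also \<open>\<gamma> = 0\<close> and both sides
        vanish; otherwise one factor \<open>r\<close> cancels.\<close>
      using gamma_0 by (cases "r = 0"; simp add: C_def S_def)+
    moreover have "mat_power (mat2 0 (cnj \<gamma>) \<gamma> 0) (Suc n)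
        = mat2 0 (cnj \<gamma>) \<gamma> 0 ** mat_power (mat2 0 (cnj \<gamma>) \<gamma> 0) n"
      by (simp add: mat_power_def)
    ultimately show ?case
      unfolding Suc.IH mat2_mult by (simp add: mult_ac)
  qed
  have "C n / fact n = (if even n then r ^ n /\<^sub>R fact n else 0)" for n
    by (simp add: C_def divide_inverse)
  then have "(\<lambda>n. C n / fact n) sums cosh r"
    using cosh_converges[of r] by simp
  from sums_of_real[OF this, where 'a = complex]
  have C_sums: "(\<lambda>n. complex_of_real (1 / fact n) * of_real (C n)) sums of_real (cosh r)"
    by simp
  have "S n / fact n = (if even n then 0 else r ^ n /\<^sub>R fact n)" for n
    by (simp add: S_def divide_inverse)
  then have "(\<lambda>n. S n / fact n) sums sinh r"
    using sinh_converges[of r] by simp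
  from sums_of_real[OF this, where 'a = complex]
  have S_sums: "(\<lambda>n. complex_of_real (1 / fact n) * (x * of_real (S n))) sums (x * of_real (sinh r))" for x
    by (auto dest: sums_mult[of _ _ x] simp: mult_ac)
  show ?thesis
    unfolding mat_exp_def pow scaleR_mat2
    by (intro sums_unique[symmetric] sums_mat2 C_sums S_sums)
qed

text \<open>As exp maps the reals onto the positive reals, the exponential can be traded for a
  positive parameter \<open>t\<close>, which makes the equations for the factors algebraic.\<close>

lemma mat_exp_i_t:
  "e \<in> mat_exp ` i_t \<longleftrightarrow> (\<exists>t>0. e = mat2 (of_real t) 0 0 (of_real (1 / t)))"
proof
  assume "e \<in> mat_exp ` i_t"
  then obtain s where "e = mat_exp (mat2 (of_real s) 0 0 (- of_real s))"
    by (auto simp: i_t_def)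
  then show "\<exists>t>0. e = mat2 (of_real t) 0 0 (of_real (1 / t))"
    by (intro exI[of _ "exp s"]) (simp add: mat_exp_diagonal exp_minus field_simps)
next
  assume "\<exists>t>0. e = mat2 (of_real t) 0 0 (of_real (1 / t))"
  then obtain t where "t > 0" "e = mat2 (of_real t) 0 0 (of_real (1 / t))"
    by blast
  then have "e = mat_exp (mat2 (of_real (ln t)) 0 0 (- of_real (ln t)))"
    unfolding mat_exp_diagonal by (simp add: exp_minus field_simps)
  then show "e \<in> mat_exp ` i_t"
    by (auto simp: i_t_def)
qed

text \<open>For \<open>\<beta> \<noteq> 0\<close> the phase has modulus 1 and this is cosh^2 = 1 +
  sinh^2; for \<open>\<beta> = 0\<close> the quotient is 0, in agreement with sinh 0 = 0. It
  expresses det f = 1.\<close>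

lemma cosh_sinh_normalized:
  fixes \<beta> :: complex
  shows "(cosh (cmod \<beta>))\<^sup>2 = 1 + (cmod (\<beta> / of_real (cmod \<beta>) * of_real (sinh (cmod \<beta>))))\<^sup>2"
  by (cases "\<beta> = 0") (simp_all add: norm_mult norm_divide cosh_square_eq)

text \<open>Forgets \<open>\<gamma>\<close> and keeps the positive diagonal and the determinant
  condition, which is what uniqueness works with.\<close>

lemma mat_exp_i_m:
  assumes "f \<in> mat_exp ` i_m"
  obtains h w where "h > 0" "h\<^sup>2 = 1 + (cmod w)\<^sup>2" "f = mat2 (of_real h) w (cnj w) (of_real h)"
proof -
  from assms obtain \<gamma> where f: "f = mat_exp (mat2 0 (cnj \<gamma>) \<gamma> 0)"
    by (auto simp: i_m_def)
  show thesis
    by (rule that[of "cosh (cmod \<gamma>)" "cnj \<gamma> / of_real (cmod \<gamma>) * of_real (sinh (cmod \<gamma>))"])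
      (use cosh_sinh_normalized[of "cnj \<gamma>"] in \<open>simp_all add: f mat_exp_antidiagonal\<close>)
qed

section \<open>The Gram equation for the factors\<close>

text \<open>Forwards, \<open>k\<close> cancels from the Gram matrix because its adjoint is its
  inverse. Backwards, the formula for \<open>k\<close> gives the factorization at once, the Gram
  equation makes \<open>k\<close> unitary, and multiplicativity of det gives det k = 1.\<close>

lemma SU2_factor_iff:
  assumes "g \<in> SL2" "det e = 1" "det f = 1" "conj_transpose e = e" "conj_transpose f = f"
  shows "k \<in> SU2 \<and> g = k ** f ** e
    \<longleftrightarrow> conj_transpose g ** g = e ** f ** f ** e \<and> k = g ** matrix_inv e ** matrix_inv f"
proof -
  have "invertible e" "invertible f"
    using assms by (simp_all add: invertible_det_nz)
  then have inv: "e ** matrix_inv e = mat 1" "matrix_inv e ** e = mat 1"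
      "f ** matrix_inv f = mat 1" "matrix_inv f ** f = mat 1"
    by (simp_all add: matrix_inv_inverse)
  have inv_cancel: "A ** e ** matrix_inv e = A" "A ** matrix_inv e ** e = A"
      "A ** f ** matrix_inv f = A" "A ** matrix_inv f ** f = A" for A :: cmat2
    by (simp_all add: inv flip: matrix_mul_assoc)
  show ?thesis
  proof (intro iffI conjI; elim conjE)
    assume k: "k \<in> SU2" and g: "g = k ** f ** e"
    have "conj_transpose g ** g = e ** f ** (conj_transpose k ** k) ** f ** e"
      unfolding g conj_transpose_mult assms by (simp add: matrix_mul_assoc)
    then show "conj_transpose g ** g = e ** f ** f ** e"
      using k by (simp add: SU2_def)
    show "k = g ** matrix_inv e ** matrix_inv f"
      by (simp add: g inv_cancel)
  next
    assume gram: "conj_transpose g ** g = e ** f ** f ** e"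
      and k: "k = g ** matrix_inv e ** matrix_inv f"
    show g: "g = k ** f ** e"
      by (simp add: k inv_cancel)
    \<comment> \<open>For hermitian \<open>f\<close>, the adjoint of
      \<open>matrix_inv f ** f = mat 1\<close> says that the adjoint of the inverse is a right
      inverse of \<open>f\<close>. For square matrices it is then also a left inverse, as needed to
      cancel the left half of \<open>e ** f ** f ** e\<close>.\<close>
    have "f ** conj_transpose (matrix_inv f) = mat 1" "e ** conj_transpose (matrix_inv e) = mat 1"
      using inv assms by (metis conj_transpose_mult conj_transpose_mat_1)+
    then have left: "conj_transpose (matrix_inv f) ** f = mat 1"
        "conj_transpose (matrix_inv e) ** e = mat 1"
      by (simp_all add: matrix_left_right_inverse)
    have "conj_transpose k ** k = conj_transpose (matrix_inv f) ** conj_transpose (matrix_inv e)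
        ** (conj_transpose g ** g) ** matrix_inv e ** matrix_inv f"
      unfolding k conj_transpose_mult by (simp add: matrix_mul_assoc)
    also have "\<dots> = conj_transpose (matrix_inv f) ** (conj_transpose (matrix_inv e) ** e) ** f"
      unfolding gram by (simp add: matrix_mul_assoc inv_cancel)
    also have "\<dots> = mat 1"
      by (simp add: left)
    finally have "conj_transpose k ** k = mat 1" .
    moreover from this have "k ** conj_transpose k = mat 1"
      by (simp add: matrix_left_right_inverse)
    moreover have "det k = 1"
      using g assms by (simp add: SL2_def det_mul)
    ultimately show "k \<in> SU2"
      by (simp add: SU2_def SL2_def)
  qed
qed

lemma gram_mat2:
  "conj_transpose (mat2 a b c d) ** mat2 a b c d
     = mat2 (of_real ((cmod a)\<^sup>2 + (cmod c)\<^sup>2)) (cnj a * b + cnj c * d)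
            (cnj (cnj a * b + cnj c * d)) (of_real ((cmod b)\<^sup>2 + (cmod d)\<^sup>2))"
  by (simp add: conj_transpose_mat2 mat2_mult mat2_eq_iff complex_norm_square mult.commute
      flip: of_real_power)

text \<open>The diagonal of \<open>f ** f\<close> is h^2 + |w|^2 = 2 h^2 - 1. Multiplying by
  \<open>e\<close> on both sides scales the diagonal entries by t^2 and 1/t^2 and fixes the others,
  since t (1/t) = 1. Uniqueness uses the equivalence forwards, existence backwards.\<close>

lemma SU2_factor_mat2_iff:
  fixes a b c d w :: complex and t h :: real
  defines "e \<equiv> mat2 (of_real t) 0 0 (of_real (1 / t))"
    and "f \<equiv> mat2 (of_real h) w (cnj w) (of_real h)"
  assumes "mat2 a b c d \<in> SL2" "t > 0" "h > 0" "h\<^sup>2 = 1 + (cmod w)\<^sup>2"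
  shows "k \<in> SU2 \<and> mat2 a b c d = k ** f ** e \<longleftrightarrow>
      (cmod a)\<^sup>2 + (cmod c)\<^sup>2 = t\<^sup>2 * (2 * h\<^sup>2 - 1) \<and>
      (cmod b)\<^sup>2 + (cmod d)\<^sup>2 = (2 * h\<^sup>2 - 1) / t\<^sup>2 \<and>
      cnj a * b + cnj c * d = 2 * of_real h * w \<and>
      k = mat2 a b c d ** matrix_inv e ** matrix_inv f"
proof -
  have w: "w * cnj w = of_real (h\<^sup>2 - 1)"
    using assms by (simp add: complex_norm_square flip: of_real_power)
  have "det e = 1" "conj_transpose e = e" "conj_transpose f = f"
    using assms(4) by (simp_all add: e_def f_def det_mat2 conj_transpose_mat2)
  moreover have "det f = 1"
    using w by (simp add: f_def det_mat2 power2_eq_square)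
  ultimately have "det e = 1" "det f = 1" "conj_transpose e = e" "conj_transpose f = f"
    by blast+
  note iff = SU2_factor_iff[OF assms(3) this]
  have "f ** f = mat2 (of_real (2 * h\<^sup>2 - 1)) (2 * of_real h * w) (2 * of_real h * cnj w) (of_real (2 * h\<^sup>2 - 1))"
    using w by (simp add: f_def mat2_mult mat2_eq_iff power2_eq_square mult_ac)
  then have eq: "e ** (f ** f) ** e = mat2 (of_real (t\<^sup>2 * (2 * h\<^sup>2 - 1))) (2 * of_real h * w)
      (cnj (2 * of_real h * w)) (of_real ((2 * h\<^sup>2 - 1) / t\<^sup>2))"
    using \<open>t > 0\<close> by (simp add: e_def mat2_mult mat2_eq_iff power2_eq_square)
  \<comment> \<open>Both matrices are hermitian, so the lower left equation is the conjugate of the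
    upper right one and three scalar equations remain.\<close>
  then show ?thesis
    unfolding iff gram_mat2 eq[unfolded matrix_mul_assoc] mat2_eq_iff of_real_eq_iff complex_cnj_cancel_iff
    by blast
qed

section \<open>Uniqueness of the triple\<close>

lemma mostow_triple_parameters:
  fixes a b c d :: complex
  assumes SL2: "mat2 a b c d \<in> SL2" and triple: "is_mostow_triple (mat2 a b c d) (k, f, e)"
  obtains t h :: real and w :: complex
  where "t > 0" "h > 0" "h\<^sup>2 = 1 + (cmod w)\<^sup>2"
    "(cmod a)\<^sup>2 + (cmod c)\<^sup>2 = t\<^sup>2 * (2 * h\<^sup>2 - 1)"
    "(cmod b)\<^sup>2 + (cmod d)\<^sup>2 = (2 * h\<^sup>2 - 1) / t\<^sup>2"
    "cnj a * b + cnj c * d = 2 * of_real h * w"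
    "e = mat2 (of_real t) 0 0 (of_real (1 / t))" "f = mat2 (of_real h) w (cnj w) (of_real h)"
    "k = mat2 a b c d ** matrix_inv e ** matrix_inv f"
proof -
  from triple have k: "k \<in> SU2 \<and> mat2 a b c d = k ** f ** e"
    and "f \<in> mat_exp ` i_m" "e \<in> mat_exp ` i_t"
    by (simp_all add: is_mostow_triple_def)
  then obtain t h w where t: "t > 0" and e: "e = mat2 (of_real t) 0 0 (of_real (1 / t))"
    and h: "h > 0" "h\<^sup>2 = 1 + (cmod w)\<^sup>2" and f: "f = mat2 (of_real h) w (cnj w) (of_real h)"
    unfolding mat_exp_i_t by (metis mat_exp_i_m)
  have "(k \<in> SU2 \<and> mat2 a b c d = k ** f ** e) \<longleftrightarrow>
      (cmod a)\<^sup>2 + (cmod c)\<^sup>2 = t\<^sup>2 * (2 * h\<^sup>2 - 1) \<and>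
      (cmod b)\<^sup>2 + (cmod d)\<^sup>2 = (2 * h\<^sup>2 - 1) / t\<^sup>2 \<and>
      cnj a * b + cnj c * d = 2 * of_real h * w \<and>
      k = mat2 a b c d ** matrix_inv e ** matrix_inv f"
    unfolding e f by (rule SU2_factor_mat2_iff[OF SL2 t h])
  with k that[OF t h _ _ _ e f] show thesis
    by blast
qed

lemma mostow_triple_unique:
  assumes SL2: "mat2 a b c d \<in> SL2"
    and "is_mostow_triple (mat2 a b c d) p" "is_mostow_triple (mat2 a b c d) p'"
  shows "p = p'"
proof -
  obtain k f e k' f' e' where p: "p = (k, f, e)" "p' = (k', f', e')"
    by (metis surj_pair)
  from mostow_triple_parameters[OF SL2 assms(2)[unfolded p]] obtain t h w
    where 1: "t > 0" "h > 0" "h\<^sup>2 = 1 + (cmod w)\<^sup>2"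
      "(cmod a)\<^sup>2 + (cmod c)\<^sup>2 = t\<^sup>2 * (2 * h\<^sup>2 - 1)"
      "(cmod b)\<^sup>2 + (cmod d)\<^sup>2 = (2 * h\<^sup>2 - 1) / t\<^sup>2"
      "cnj a * b + cnj c * d = 2 * of_real h * w"
      "e = mat2 (of_real t) 0 0 (of_real (1 / t))" "f = mat2 (of_real h) w (cnj w) (of_real h)"
      "k = mat2 a b c d ** matrix_inv e ** matrix_inv f" .
  from mostow_triple_parameters[OF SL2 assms(3)[unfolded p]] obtain t' h' w'
    where 2: "t' > 0" "h' > 0" "h'\<^sup>2 = 1 + (cmod w')\<^sup>2"
      "(cmod a)\<^sup>2 + (cmod c)\<^sup>2 = t'\<^sup>2 * (2 * h'\<^sup>2 - 1)"
      "(cmod b)\<^sup>2 + (cmod d)\<^sup>2 = (2 * h'\<^sup>2 - 1) / t'\<^sup>2"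
      "cnj a * b + cnj c * d = 2 * of_real h' * w'"
      "e' = mat2 (of_real t') 0 0 (of_real (1 / t'))" "f' = mat2 (of_real h') w' (cnj w') (of_real h')"
      "k' = mat2 a b c d ** matrix_inv e' ** matrix_inv f'" .
  \<comment> \<open>2 h^2 - 1 = 1 + 2 |w|^2, so this common factor can be cancelled when the two
    diagonal equations are divided.\<close>
  have pos: "2 * h\<^sup>2 - 1 > 0" "2 * h'\<^sup>2 - 1 > 0"
    unfolding 1(3) 2(3) by (simp_all add: add_pos_nonneg)
  have "t ^ 4 = ((cmod a)\<^sup>2 + (cmod c)\<^sup>2) / ((cmod b)\<^sup>2 + (cmod d)\<^sup>2)"
    using pos 1 unfolding 1(4,5) by (simp add: field_simps power_numeral_reduce)
  moreover have "t' ^ 4 = ((cmod a)\<^sup>2 + (cmod c)\<^sup>2) / ((cmod b)\<^sup>2 + (cmod d)\<^sup>2)"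
    using pos 2 unfolding 2(4,5) by (simp add: field_simps power_numeral_reduce)
  ultimately have t: "t = t'"
    using 1(1) 2(1) by (metis less_le power_eq_iff_eq_base zero_less_numeral)
  with 1(1,4) 2(4) have "h\<^sup>2 = h'\<^sup>2"
    by simp
  then have h: "h = h'"
    using 1(2) 2(2) by (simp add: power2_eq_iff_nonneg)
  with 1(2,6) 2(6) have "w = w'"
    by simp
  then show ?thesis
    unfolding p 1(7-9) 2(7-9) using t h by simp
qed

section \<open>Existence with the explicit \<open>\<alpha>\<close> and
  \<open>\<beta>\<close>\<close>

text \<open>The Gram matrix has determinant |det g|^2. Passing to complex numbers turns each squared
  modulus into a product \<open>x * cnj x\<close> and leaves a polynomial identity.\<close>

lemma gram_det_identity:
  fixes a b c d :: complex
  shows "((cmod a)\<^sup>2 + (cmod c)\<^sup>2) * ((cmod b)\<^sup>2 + (cmod d)\<^sup>2)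
    = (cmod (a * d - b * c))\<^sup>2 + (cmod (cnj a * b + cnj c * d))\<^sup>2"
proof -
  have "complex_of_real (((cmod a)\<^sup>2 + (cmod c)\<^sup>2) * ((cmod b)\<^sup>2 + (cmod d)\<^sup>2))
    = of_real ((cmod (a * d - b * c))\<^sup>2 + (cmod (cnj a * b + cnj c * d))\<^sup>2)"
    unfolding of_real_mult of_real_add complex_norm_square by (simp add: algebra_simps)
  then show ?thesis
    unfolding of_real_eq_iff .
qed

text \<open>Since (s + r) (s - r) = 1, the numbers s + r and s - r are exp x and exp (-x) for x = ln
  (s + r); cosh and sinh are half their sum and half their difference.\<close>

lemma cosh_sinh_ln:
  fixes r s :: real
  assumes "s > 0" "r \<ge> 0" "s\<^sup>2 = 1 + r\<^sup>2"
  shows "ln (s + r) \<ge> 0" "cosh (ln (s + r)) = s" "sinh (ln (s + r)) = r"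
proof -
  have "s \<ge> 1"
    using assms by (intro power2_le_imp_le[of 1 s]) simp_all
  then show "ln (s + r) \<ge> 0"
    using assms by simp
  have "(s + r) * (s - r) = 1"
    using assms by (simp add: algebra_simps power2_eq_square)
  then have "inverse (s + r) = s - r"
    by (simp add: inverse_unique)
  then show "cosh (ln (s + r)) = s" "sinh (ln (s + r)) = r"
    using assms by (simp_all add: cosh_ln_real sinh_ln_real)
qed

theorem proposition2:
  fixes a b c d \<beta> :: complex and \<alpha> :: real and e f k :: cmat2
  assumes "mat2 a b c d \<in> SL2"
    and "\<alpha> = (((cmod a)\<^sup>2 + (cmod c)\<^sup>2) / ((cmod b)\<^sup>2 + (cmod d)\<^sup>2)) powr (1/4)"
    and "e = mat2 (of_real \<alpha>) 0 0 (of_real (1 / \<alpha>))"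
    and "\<beta> = (if cnj a * b + cnj c * d = 0 then 0
              else (cnj a * b + cnj c * d) / of_real (cmod (cnj a * b + cnj c * d))
                * of_real (ln (sqrt (((cmod a)\<^sup>2 + (cmod c)\<^sup>2) * ((cmod b)\<^sup>2 + (cmod d)\<^sup>2))
                                 + cmod (cnj a * b + cnj c * d)) / 2))"
    and "f = (if cnj a * b + cnj c * d = 0 then mat 1
              else mat2 (of_real (cosh (cmod \<beta>)))
                        (\<beta> / of_real (cmod \<beta>) * of_real (sinh (cmod \<beta>)))
                        (cnj \<beta> / of_real (cmod \<beta>) * of_real (sinh (cmod \<beta>)))
                        (of_real (cosh (cmod \<beta>))))"
    and "k = mat2 a b c d ** matrix_inv e ** matrix_inv f"
  shows "e \<in> mat_exp ` i_t \<and> f \<in> mat_exp ` i_m \<and> k \<in> SU2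
    \<and> mat2 a b c d = k ** f ** e
    \<and> (\<exists>!p. is_mostow_triple (mat2 a b c d) p)
    \<and> mostow_decomposition (mat2 a b c d) = (k, f, e)"
proof -
  define P where "P = (cmod a)\<^sup>2 + (cmod c)\<^sup>2"
  define Q where "Q = (cmod b)\<^sup>2 + (cmod d)\<^sup>2"
  define z where "z = cnj a * b + cnj c * d"
  define h where "h = cosh (cmod \<beta>)"
  define w where "w = \<beta> / of_real (cmod \<beta>) * of_real (sinh (cmod \<beta>))"
  have "a * d - b * c = 1"
    using assms(1) by (simp add: SL2_def det_mat2)
  then have PQ: "P * Q = 1 + (cmod z)\<^sup>2"
    using gram_det_identity[of a c b d] by (simp add: P_def Q_def z_def)
  have "P \<ge> 0" "Q \<ge> 0"
    by (simp_all add: P_def Q_def)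
  moreover have "P * Q > 0"
    unfolding PQ by (simp add: add_pos_nonneg)
  ultimately have pos: "P > 0" "Q > 0"
    by (auto simp: zero_less_mult_iff)
  then have "sqrt (P * Q) > 0" "(sqrt (P * Q))\<^sup>2 = 1 + (cmod z)\<^sup>2"
    using pos PQ by (simp_all add: add_pos_nonneg)
  note hyp = cosh_sinh_ln[OF this(1) norm_ge_zero this(2)]
  have beta: "\<beta> = (if z = 0 then 0 else z / of_real (cmod z) * of_real (ln (sqrt (P * Q) + cmod z) / 2))"
    unfolding assms(4) P_def Q_def z_def by simp
  \<comment> \<open>The logarithm is nonnegative, so taking the modulus of \<open>\<beta>\<close>
    leaves it unchanged. For \<open>z = 0\<close> one has P Q = 1 and the logarithm is 0.\<close>
  have two_beta: "2 * cmod \<beta> = ln (sqrt (P * Q) + cmod z)"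
    using hyp(1) by (auto simp: beta norm_mult norm_divide PQ)
  have cosh2: "cosh (2 * cmod \<beta>) = sqrt (P * Q)" and sinh2: "sinh (2 * cmod \<beta>) = cmod z"
    unfolding two_beta by (fact hyp)+
  \<comment> \<open>The case \<open>mat 1\<close> fits the general form: there
    \<open>\<beta> = 0\<close>, hence \<open>h = 1\<close> and \<open>w = 0\<close>.\<close>
  have f: "f = mat2 (of_real h) w (cnj w) (of_real h)"
    unfolding assms(5) h_def w_def by (auto simp: assms(4) mat_1_eq_mat2)
  have h: "h > 0" "h\<^sup>2 = 1 + (cmod w)\<^sup>2"
    using cosh_sinh_normalized[of \<beta>] by (simp_all add: h_def w_def)
  have h2: "2 * h\<^sup>2 - 1 = sqrt (P * Q)"
    using cosh_double_cosh[of "cmod \<beta>"] by (simp add: h_def cosh2)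
  have z: "2 * of_real h * w = z"
  proof -
    \<comment> \<open>Double angle: 2 cosh x sinh x = sinh (2 x) at x = |\<beta>|.\<close>
    have "2 * of_real h * w = \<beta> / of_real (cmod \<beta>) * of_real (cmod z)"
      using sinh_double[of "cmod \<beta>"] by (simp add: h_def w_def flip: sinh2)
    also have "\<dots> = z"
    proof (cases "z = 0")
      case False
      define l where "l = ln (sqrt (P * Q) + cmod z) / 2"
      \<comment> \<open>This excludes \<open>l = 0\<close>, so dividing \<open>\<beta>\<close> by
        its modulus \<open>l\<close> recovers the phase of \<open>z\<close>.\<close>
      have "sinh (2 * cmod \<beta>) \<noteq> 0"
        using False by (simp add: sinh2)
      then have "l > 0" and l: "cmod \<beta> = l"
        using two_beta hyp(1) by (auto simp: l_def)
      then show ?thesis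
        using False unfolding l by (simp add: beta flip: l_def)
    qed simp
    finally show ?thesis .
  qed
  have "\<alpha> > 0"
    using pos by (simp add: assms(2) flip: P_def Q_def)
  have "\<alpha>\<^sup>2 = (P / Q) powr (1/4) * (P / Q) powr (1/4)"
    unfolding assms(2) P_def Q_def power2_eq_square ..
  also have "\<dots> = (P / Q) powr (1/2)"
    by (simp flip: powr_add)
  finally have alpha2: "\<alpha>\<^sup>2 = sqrt P / sqrt Q"
    using pos by (simp add: powr_half_sqrt real_sqrt_divide)
  \<comment> \<open>Product and quotient of sqrt P sqrt Q and sqrt P / sqrt Q.\<close>
  have "P = \<alpha>\<^sup>2 * (2 * h\<^sup>2 - 1)" "Q = (2 * h\<^sup>2 - 1) / \<alpha>\<^sup>2"
    unfolding alpha2 h2 using pos by (simp_all add: real_sqrt_mult)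
  with z have "k \<in> SU2 \<and> mat2 a b c d = k ** f ** e"
    unfolding assms(3) f
    by (intro SU2_factor_mat2_iff[OF assms(1) \<open>\<alpha> > 0\<close> h, THEN iffD2])
      (simp add: assms(3,6) P_def Q_def z_def f)
  moreover have "e \<in> mat_exp ` i_t"
    using \<open>\<alpha> > 0\<close> by (auto simp: mat_exp_i_t assms(3))
  moreover have "f \<in> mat_exp ` i_m"
  proof -
    \<comment> \<open>The parameter of \<open>i_m\<close> is the lower left entry, whereas
      \<open>\<beta>\<close> belongs to the upper right one; hence the generator is given by
      \<open>cnj \<beta>\<close>.\<close>
    have "f = mat_exp (mat2 0 (cnj (cnj \<beta>)) (cnj \<beta>) 0)"
      unfolding mat_exp_antidiagonal by (simp add: f h_def w_def)
    then show ?thesis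
      unfolding i_m_def by blast
  qed
  ultimately have triple: "is_mostow_triple (mat2 a b c d) (k, f, e)"
    by (simp add: is_mostow_triple_def)
  have unique: "p = (k, f, e)" if "is_mostow_triple (mat2 a b c d) p" for p
    using mostow_triple_unique[OF assms(1) that triple] .
  have "mostow_decomposition (mat2 a b c d) = (k, f, e)"
    unfolding mostow_decomposition_def by (rule the_equality) (fact triple, fact unique)
  moreover have "\<exists>!p. is_mostow_triple (mat2 a b c d) p"
    by (rule ex1I) (fact triple, fact unique)
  ultimately show ?thesis
    using triple by (simp add: is_mostow_triple_def)
qed

end
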